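(* Let $\mathcal{G}$ be a connected graph with at least two vertices, regarded as a hypergraph. Then $$hk(\mathcal{G}) = |E(\mathcal{G})|-|V(\mathcal{G})|+2.$$
   Context: A hypergraph $\mathcal{H}$ consists of a finite nonempty vertex set $V(\mathcal{H})$ and a set $E(\mathcal{H})$ of subsets of $V(\mathcal{H})$ called hyperedges. All hypergraphs may have isolated vertices (vertices in no hyperedge) but have no loops, so every hyperedge has at least two vertices. A hypergraph is called a graph if every hyperedge has exactly two vertices. For a finite set $I$ disjoint from $V(\mathcal{H})$, $\mathcal{H}\cup I$ is the hypergraph with vertex set $V(\mathcal{H})\cup I$ and hyperedge set $E(\mathcal{H})$. For a digraph $D$ and a vertex $v$, the in-neighborhood is $N_D^-(v)=\{x : (x,v)\in A(D)\}$. The competition hypergraph $C\mathcal{H}(D)$ of $D$ is the hypergraph with vertex set $V(D)$ in which $e\subseteq V(D)$ is a hyperedge if and only if $|e|\ge 2$ and $e=N_D^-(v)$ for some vertex $v$ of $D$. The hypercompetition number $hk(\mathcal{H})$ is the smallest integer $k\ge 0$ such that $\mathcal{H}\cup I$, where $I$ is a set of $k$ new isolated vertices, is the competition hypergraph of some acyclic digraph (one with no directed cycles, in particular no loops). *)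

theory Defs
  imports Graph_Theory.Pair_Digraph Graph_Theory.Digraph_Component
begin

record 'a hypergraph =
  hverts :: "'a set"
  hedges :: "'a set set"

definition is_hypergraph :: "'a hypergraph \<Rightarrow> bool" where
  "is_hypergraph H \<longleftrightarrow>
     finite (hverts H) \<and> hverts H \<noteq> {} \<and>
     (\<forall>e\<in>hedges H. e \<subseteq> hverts H \<and> 2 \<le> card e)"

definition is_graph :: "'a hypergraph \<Rightarrow> bool" where
  "is_graph H \<longleftrightarrow> is_hypergraph H \<and> (\<forall>e\<in>hedges H. card e = 2)"

(* An undirected graph is viewed as the symmetric digraph with both orientations of every
   edge, so that the connectedness predicate of Graph_Theory applies.  Hyperedges with more
   than two vertices would be ignored: use only together with is_graph. *)
definition is_connected_graph :: "'a hypergraph \<Rightarrow> bool" where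
  "is_connected_graph G \<longleftrightarrow>
     is_graph G \<and>
     connected (with_proj \<lparr> pverts = hverts G, parcs = {(u, v). {u, v} \<in> hedges G} \<rparr>)"

definition add_isolated :: "'a hypergraph \<Rightarrow> 'a set \<Rightarrow> 'a hypergraph" where
  "add_isolated H I = \<lparr> hverts = hverts H \<union> I, hedges = hedges H \<rparr>"

definition map_hypergraph :: "('a \<Rightarrow> 'b) \<Rightarrow> 'a hypergraph \<Rightarrow> 'b hypergraph" where
  "map_hypergraph f H = \<lparr> hverts = f ` hverts H, hedges = (\<lambda>e. f ` e) ` hedges H \<rparr>"

definition in_neighborhood :: "'a pair_pre_digraph \<Rightarrow> 'a \<Rightarrow> 'a set" where
  "in_neighborhood D v = {x. (x, v) \<in> parcs D}"

definition competition_hypergraph :: "'a pair_pre_digraph \<Rightarrow> 'a hypergraph" where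
  "competition_hypergraph D =
     \<lparr> hverts = pverts D,
       hedges = {e. e \<subseteq> pverts D \<and> 2 \<le> card e \<and> (\<exists>v\<in>pverts D. e = in_neighborhood D v)} \<rparr>"

(* cycle counts loops and pairs of opposite arcs as cycles. *)
definition acyclic_digraph :: "'a pair_pre_digraph \<Rightarrow> bool" where
  "acyclic_digraph D \<longleftrightarrow> pair_fin_digraph D \<and> \<not> (\<exists>p. pre_digraph.cycle (with_proj D) p)"

(* The copy of H along Inl only makes room for new vertices: the type 'a may be finite. *)
definition hypercompetition_realizable :: "'a hypergraph \<Rightarrow> nat \<Rightarrow> bool" where
  "hypercompetition_realizable H k \<longleftrightarrow>
     (\<exists>(I :: ('a + nat) set) D.
        finite I \<and> card I = k \<and> I \<inter> hverts (map_hypergraph Inl H) = {} \<and>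
        acyclic_digraph D \<and>
        competition_hypergraph D = add_isolated (map_hypergraph Inl H) I)"

definition hypercompetition_number :: "'a hypergraph \<Rightarrow> nat" where
  "hypercompetition_number H = (LEAST k. hypercompetition_realizable H k)"

(* The minimum defining the hypercompetition number is over a nonempty set: one new
   vertex per hyperedge suffices. *)
lemma hypercompetition_realizable_card_hedges:
  fixes H :: "'a hypergraph"
  assumes H: "is_hypergraph H"
  shows "hypercompetition_realizable H (card (hedges H))"
proof -
  let ?V = "hverts H" and ?E = "hedges H"
  have fV: "finite ?V" and E: "\<And>e. e \<in> ?E \<Longrightarrow> e \<subseteq> ?V \<and> 2 \<le> card e"
    using H by (auto simp: is_hypergraph_def)
  have "?E \<subseteq> Pow ?V" using E by auto
  then have fE: "finite ?E" using fV by (meson finite_Pow_iff finite_subset)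
  then obtain f :: "'a set \<Rightarrow> nat" where f: "inj_on f ?E"
    using ex_bij_betw_finite_nat[OF fE] by (auto simp: bij_betw_def)
  define I :: "('a + nat) set" where "I = (\<lambda>e. Inr (f e)) ` ?E"
  define D :: "('a + nat) pair_pre_digraph" where
    "D = \<lparr> pverts = Inl ` ?V \<union> I, parcs = {(Inl x, Inr (f e)) | x e. e \<in> ?E \<and> x \<in> e} \<rparr>"
  have fI: "finite I" using fE by (simp add: I_def)
  have cI: "card I = card ?E"
    unfolding I_def using f by (intro card_image) (auto simp: inj_on_def)
  have sub: "parcs D \<subseteq> Inl ` ?V \<times> I"
    using E by (auto simp: D_def I_def)
  have fin: "pair_fin_digraph D"
  proof
    show "finite (parcs D)" using sub fV fI by (meson finite_SigmaI finite_imageI finite_subset)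
    show "finite (pverts D)" using fV fI by (simp add: D_def)
    show "fst e \<in> pverts D" "snd e \<in> pverts D" if "e \<in> parcs D" for e
    proof -
      have "e \<in> Inl ` ?V \<times> I" using sub that by blast
      then show "fst e \<in> pverts D" "snd e \<in> pverts D" by (auto simp: D_def)
    qed
  qed
  interpret pair_fin_digraph D by (fact fin)
  have nocyc: "\<not> (\<exists>p. pre_digraph.cycle (with_proj D) p)"
  proof
    assume "\<exists>p. pre_digraph.cycle (with_proj D) p"
    then obtain u p where p: "awalk u p u" "p \<noteq> []"
      by (auto simp: pre_digraph.cycle_def)
    have "set p \<subseteq> parcs D" "pcas u p u" using p by (auto simp: awalk_def)
    then have "set p \<subseteq> Inl ` ?V \<times> I" "pcas u p u" using sub by auto
    moreover obtain a q where "p = a # q" using p(2) by (cases p) auto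
    ultimately show False by (cases q) (auto simp: I_def)
  qed
  have nb: "in_neighborhood D (Inr (f e)) = Inl ` e" if "e \<in> ?E" for e
    using that f by (auto simp: in_neighborhood_def D_def inj_on_def)
  have nb0: "in_neighborhood D (Inl x) = {}" for x
    by (auto simp: in_neighborhood_def D_def)
  have card_Inl: "card (Inl ` e :: ('a + nat) set) = card e" for e
    by (intro card_image) auto
  have "competition_hypergraph D = add_isolated (map_hypergraph Inl H) I"
  proof -
    have "{e. e \<subseteq> pverts D \<and> 2 \<le> card e \<and> (\<exists>v\<in>pverts D. e = in_neighborhood D v)}
        = (\<lambda>e. Inl ` e) ` ?E" (is "?L = ?R")
    proof (intro subset_antisym subsetI)
      fix e assume "e \<in> ?L"
      then obtain v where v: "v \<in> pverts D" "e = in_neighborhood D v" "2 \<le> card e" by auto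
      with nb0 have "v \<in> I" by (auto simp: D_def)
      with v nb show "e \<in> ?R" by (auto simp: I_def)
    next
      fix e assume "e \<in> ?R"
      then obtain e' where e': "e' \<in> ?E" "e = Inl ` e'" by auto
      moreover have "Inr (f e') \<in> pverts D" using e' by (auto simp: D_def I_def)
      moreover have "e \<subseteq> pverts D" using e' E[of e'] by (auto simp: D_def)
      moreover have "2 \<le> card e" using e' E[of e'] by (simp add: card_Inl)
      ultimately show "e \<in> ?L" using nb[of e'] by blast
    qed
    then show ?thesis
      by (simp add: competition_hypergraph_def add_isolated_def map_hypergraph_def D_def)
  qed
  moreover have "I \<inter> hverts (map_hypergraph Inl H) = {}"
    by (auto simp: I_def map_hypergraph_def)
  ultimately show ?thesis
    unfolding hypercompetition_realizable_def acyclic_digraph_def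
    using fI cI fin nocyc by blast
qed

end

theory Submission
  imports Defs
begin

text \<open>
  In an acyclic digraph, the first vertex of a topological order has no in-neighbour and the
  second has at most one, so neither can be the head that witnesses a competition hyperedge.
  The other vertices witness at most one hyperedge each, namely their in-neighbourhood.  If
  \<open>k\<close> new vertices suffice for \<open>G\<close>, this gives \<open>card (hedges G) \<le> card (hverts G) + k - 2\<close>.

  For a connected graph no other obstruction occurs.  Enumerate the vertices as \<open>v 0, v 1, \<dots>\<close> so
  that every vertex after the first is adjacent to an earlier one
  (\<open>connected_graph_ordering\<close>).  The chosen edge joining \<open>v (i - 1)\<close> to an earlier vertex has
  both ends before \<open>v i\<close>, so for \<open>i \<ge> 2\<close> it can be the in-neighbourhood of \<open>v i\<close>.  These edges
  are pairwise distinct because they have different last vertices.  They use every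
  vertex except the two that are excluded in any case, and each of the remaining
  \<open>card (hedges G) - (card (hverts G) - 2)\<close> edges gets a new vertex as its head
  (\<open>hypercompetition_realizable_if_heads_in_ordering\<close>).
\<close>

section \<open>Acyclic digraphs and hypergraphs\<close>

lemma finite_hedges:
  assumes "is_hypergraph H"
  shows "finite (hedges H)"
proof (rule finite_subset)
  show "hedges H \<subseteq> Pow (hverts H)" "finite (Pow (hverts H))"
    using assms by (auto simp: is_hypergraph_def)
qed

text \<open>
  Every nonempty closed walk contains a cycle, so the absence of cycles is acyclicity of the arc
  relation.  This makes minimal elements and rank functions available.
\<close>
lemma acyclic_digraph_iff:
  "acyclic_digraph D \<longleftrightarrow> pair_fin_digraph D \<and> acyclic (parcs D)"
proof (cases "pair_fin_digraph D")
  case True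
  interpret pair_fin_digraph D by (fact True)
  have "(\<exists>p. pre_digraph.cycle (with_proj D) p) \<longleftrightarrow> (\<exists>u p. awalk u p u \<and> p \<noteq> [])"
  proof
    assume "\<exists>p. pre_digraph.cycle (with_proj D) p"
    then show "\<exists>u p. awalk u p u \<and> p \<noteq> []" by (auto simp: pre_digraph.cycle_def)
  next
    assume "\<exists>u p. awalk u p u \<and> p \<noteq> []"
    then obtain p where "closed_w p" by (auto simp: closed_w_def)
    then show "\<exists>p. pre_digraph.cycle (with_proj D) p" using closed_w_imp_cycle by blast
  qed
  also have "\<dots> \<longleftrightarrow> \<not> acyclic (parcs D)"
    using reachable1_awalk by (auto simp: acyclic_def)
  finally show ?thesis using True by (simp add: acyclic_digraph_def)
qed (simp add: acyclic_digraph_def)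

section \<open>The lower bound\<close>

text \<open>
  Two vertices have fewer than two in-neighbours: a minimal vertex \<open>a\<close> of the arc
  relation, and a vertex \<open>b\<close> that is minimal once \<open>a\<close> is removed.  Hence all hyperedges are
  in-neighbourhoods of the remaining vertices.
\<close>
lemma card_competition_hyperedges:
  assumes "acyclic_digraph D" and "2 \<le> card (pverts D)"
  shows "card (hedges (competition_hypergraph D)) + 2 \<le> card (pverts D)"
proof -
  from assms(1) have D: "pair_fin_digraph D" and acyc: "acyclic (parcs D)"
    by (auto simp: acyclic_digraph_iff)
  interpret pair_fin_digraph D by (fact D)
  let ?V = "pverts D" and ?E = "hedges (competition_hypergraph D)"
  have wf: "wf (parcs D)" using acyc by (intro finite_acyclic_wf) auto
  have src: "in_neighborhood D v \<subseteq> ?V" for v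
    by (auto simp: in_neighborhood_def dest: in_arcsD1)
  have "?V \<noteq> {}" using assms(2) by auto
  then obtain a where a: "a \<in> ?V" "\<And>x. (x, a) \<in> parcs D \<Longrightarrow> x \<notin> ?V"
    using wf by (metis ex_in_conv wfE_min)
  have "?V - {a} \<noteq> {}"
  proof
    assume "?V - {a} = {}"
    then have "?V = {a}" using a(1) by auto
    then show False using assms(2) by simp
  qed
  then obtain b where b: "b \<in> ?V - {a}" "\<And>x. (x, b) \<in> parcs D \<Longrightarrow> x \<notin> ?V - {a}"
    using wf by (metis ex_in_conv wfE_min)
  have "in_neighborhood D a \<subseteq> {a}" "in_neighborhood D b \<subseteq> {a}"
    using a(2) b(2) src by (auto simp: in_neighborhood_def)
  then have small: "card (in_neighborhood D a) < 2" "card (in_neighborhood D b) < 2"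
    by (auto dest!: subset_singletonD)
  have "?E \<subseteq> in_neighborhood D ` (?V - {a, b})"
    using small by (auto simp: competition_hypergraph_def)
  then have "card ?E \<le> card (?V - {a, b})"
    by (intro surj_card_le) auto
  also have "\<dots> = card ?V - 2"
    using a(1) b(1) by (subst card_Diff_subset) auto
  finally show ?thesis using assms(2) by linarith
qed

lemma hypercompetition_realizable_lower_bound:
  assumes "is_hypergraph H" and "2 \<le> card (hverts H)" and "hypercompetition_realizable H k"
  shows "card (hedges H) + 2 \<le> card (hverts H) + k"
proof -
  obtain I :: "('a + nat) set" and D where I: "finite I" "card I = k"
    "I \<inter> hverts (map_hypergraph Inl H) = {}" and D: "acyclic_digraph D"
    and eq: "competition_hypergraph D = add_isolated (map_hypergraph Inl H) I"
    using assms(3) by (auto simp: hypercompetition_realizable_def)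
  have "pverts D = hverts (competition_hypergraph D)"
    by (simp add: competition_hypergraph_def)
  then have V: "pverts D = Inl ` hverts H \<union> I"
    by (simp add: eq add_isolated_def map_hypergraph_def)
  have cV: "card (pverts D) = card (hverts H) + k"
    unfolding V using assms(1) I
    by (subst card_Un_disjoint) (auto simp: is_hypergraph_def map_hypergraph_def card_image)
  have "hedges (competition_hypergraph D) = (\<lambda>e. Inl ` e) ` hedges H"
    by (simp add: eq add_isolated_def map_hypergraph_def)
  moreover have "inj_on (\<lambda>e. Inl ` e :: ('a + nat) set) (hedges H)"
    by (simp add: inj_on_def inj_image_eq_iff)
  ultimately have "card (hedges (competition_hypergraph D)) = card (hedges H)"
    by (simp add: card_image)
  then show ?thesis
    using card_competition_hyperedges[OF D] assms(2) cV by simp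
qed

section \<open>Constructing a digraph from heads of hyperedges\<close>

text \<open>
  Drawing an arc from each vertex of \<open>e\<close> to the head \<open>h e\<close> makes \<open>e\<close> the in-neighbourhood of
  \<open>h e\<close>, by injectivity of \<open>h\<close>, and leaves all other in-neighbourhoods empty.  The digraph is
  acyclic because the rank increases along every arc.
\<close>
lemma competition_hypergraph_if_ranked_heads:
  fixes r :: "'b \<Rightarrow> nat"
  assumes K: "is_hypergraph K" and inj: "inj_on h (hedges K)" and hV: "h ` hedges K \<subseteq> hverts K"
    and rank: "\<And>e x. e \<in> hedges K \<Longrightarrow> x \<in> e \<Longrightarrow> r x < r (h e)"
  shows "\<exists>D. acyclic_digraph D \<and> competition_hypergraph D = K"
proof -
  let ?V = "hverts K" and ?E = "hedges K"
  have fV: "finite ?V" and E: "\<And>e. e \<in> ?E \<Longrightarrow> e \<subseteq> ?V \<and> 2 \<le> card e"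
    using K by (auto simp: is_hypergraph_def)
  define D where "D = \<lparr> pverts = ?V, parcs = {(x, h e) | x e. e \<in> ?E \<and> x \<in> e} \<rparr>"
  have arcs: "parcs D \<subseteq> ?V \<times> ?V" using E hV by (auto simp: D_def)
  have "pair_fin_digraph D"
  proof
    show "finite (parcs D)" using arcs fV by (meson finite_SigmaI finite_subset)
    show "finite (pverts D)" using fV by (simp add: D_def)
    show "fst a \<in> pverts D" "snd a \<in> pverts D" if "a \<in> parcs D" for a
      using subsetD[OF arcs that] by (auto simp: D_def)
  qed
  moreover have "acyclic (parcs D)"
  proof (rule acyclic_subset)
    show "acyclic (measure r)" by (simp add: wf_acyclic)
    show "parcs D \<subseteq> measure r" using rank by (auto simp: D_def)
  qed
  ultimately have "acyclic_digraph D" by (simp add: acyclic_digraph_iff)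
  moreover have "competition_hypergraph D = K"
  proof -
    have nb: "in_neighborhood D (h e) = e" if "e \<in> ?E" for e
      using that inj by (auto simp: in_neighborhood_def D_def inj_on_def)
    have nb0: "in_neighborhood D v = {}" if "v \<notin> h ` ?E" for v
      using that by (auto simp: in_neighborhood_def D_def)
    have "{e. e \<subseteq> ?V \<and> 2 \<le> card e \<and> (\<exists>v\<in>?V. e = in_neighborhood D v)} = ?E"
      (is "?L = _")
    proof (intro subset_antisym subsetI)
      fix e assume "e \<in> ?L"
      then obtain v where v: "e = in_neighborhood D v" "2 \<le> card e" by auto
      with nb0[of v] have "v \<in> h ` ?E" by fastforce
      with v nb show "e \<in> ?E" by auto
    next
      fix e assume "e \<in> ?E"
      with hV have "h e \<in> ?V" by auto
      with \<open>e \<in> ?E\<close> E nb[of e] show "e \<in> ?L" by (auto intro!: bexI[of _ "h e"])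
    qed
    then show ?thesis by (simp add: competition_hypergraph_def D_def)
  qed
  ultimately show ?thesis by blast
qed

text \<open>
  An index \<open>i \<in> J\<close> stands for an old vertex \<open>v i\<close> that serves as head of the hyperedge \<open>g i\<close>,
  whose vertices all precede it.  Only the hyperedges that are not of this form need a new vertex,
  and new vertices may be placed after all old ones.
\<close>
lemma hypercompetition_realizable_if_heads_in_ordering:
  fixes H :: "'a hypergraph" and v :: "nat \<Rightarrow> 'a"
  assumes H: "is_hypergraph H" and v: "bij_betw v {..<n} (hverts H)"
    and J: "J \<subseteq> {..<n}" and g: "inj_on g J" "g ` J \<subseteq> hedges H"
    and before: "\<And>i. i \<in> J \<Longrightarrow> g i \<subseteq> v ` {..<i}"
  shows "hypercompetition_realizable H (card (hedges H - g ` J))"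
proof -
  let ?V = "hverts H" and ?E = "hedges H"
  have E: "\<And>e. e \<in> ?E \<Longrightarrow> e \<subseteq> ?V \<and> 2 \<le> card e"
    using H by (auto simp: is_hypergraph_def)
  have fE: "finite ?E" using H by (rule finite_hedges)
  then obtain f :: "'a set \<Rightarrow> nat" where f: "inj_on f ?E"
    using ex_bij_betw_finite_nat[OF fE] by (auto simp: bij_betw_def)
  define I :: "('a + nat) set" where "I = (\<lambda>e. Inr (f e)) ` (?E - g ` J)"
  define K where "K = add_isolated (map_hypergraph Inl H) I"
  \<comment> \<open>The head of a hyperedge of \<open>H\<close>; \<open>h\<close> is the same assignment for the copies in \<open>K\<close>.\<close>
  define h0 :: "'a set \<Rightarrow> 'a + nat"
    where "h0 e = (if e \<in> g ` J then Inl (v (inv_into J g e)) else Inr (f e))" for e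
  define h :: "('a + nat) set \<Rightarrow> 'a + nat" where "h c = h0 (Inl -` c)" for c
  \<comment> \<open>The old vertices have ranks below \<open>n\<close>, which is therefore free for the new ones.\<close>
  define r :: "'a + nat \<Rightarrow> nat"
    where "r z = (case z of Inl x \<Rightarrow> inv_into {..<n} v x | Inr _ \<Rightarrow> n)" for z
  have KV: "hverts K = Inl ` ?V \<union> I" and KE: "hedges K = (\<lambda>e. Inl ` e) ` ?E"
    by (auto simp: K_def add_isolated_def map_hypergraph_def)
  have h_Inl: "h (Inl ` e) = h0 e" for e
    by (simp add: h_def inj_vimage_image_eq)
  have h0_g: "h0 (g i) = Inl (v i)" if "i \<in> J" for i
    using that g(1) by (simp add: h0_def)
  have h0_new: "h0 e = Inr (f e)" if "e \<notin> g ` J" for e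
    using that by (simp add: h0_def)
  have inj_v: "inj_on v {..<n}" and v_V: "v ` {..<n} = ?V"
    using v by (auto simp: bij_betw_def)
  have r_v: "r (Inl (v i)) = i" if "i < n" for i
    using that inj_v by (simp add: r_def)
  have finI: "finite I" using fE by (simp add: I_def)
  have "card I = card (?E - g ` J)"
    unfolding I_def using f by (intro card_image) (auto simp: inj_on_def)
  moreover have "I \<inter> hverts (map_hypergraph Inl H) = {}"
    by (auto simp: I_def map_hypergraph_def)
  moreover have "\<exists>D. acyclic_digraph D \<and> competition_hypergraph D = K"
  proof (rule competition_hypergraph_if_ranked_heads)
    show "is_hypergraph K"
      using H E finI by (auto simp: is_hypergraph_def KV KE card_image)
    show "inj_on h (hedges K)"
    proof (rule inj_onI)
      fix c d assume "c \<in> hedges K" "d \<in> hedges K" "h c = h d"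
      then obtain e e' where e: "c = Inl ` e" "d = Inl ` e'" "e \<in> ?E" "e' \<in> ?E" "h0 e = h0 e'"
        by (auto simp: KE h_Inl)
      have "e = e'"
      proof (cases "e \<in> g ` J \<and> e' \<in> g ` J")
        case True
        then obtain i j where "e = g i" "e' = g j" "i \<in> J" "j \<in> J" by auto
        then show ?thesis using e(5) inj_v J by (auto simp: h0_g inj_on_def)
      next
        case False
        then show ?thesis using e f by (auto simp: h0_g h0_new inj_on_def h0_def split: if_splits)
      qed
      then show "c = d" using e by simp
    qed
    show "h ` hedges K \<subseteq> hverts K"
    proof -
      have "h0 e \<in> hverts K" if "e \<in> ?E" for e
      proof (cases "e \<in> g ` J")
        case True
        then obtain i where i: "i \<in> J" "e = g i" by auto
        then have "v i \<in> ?V" using J v_V by blast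
        then show ?thesis using i by (simp add: h0_g KV)
      qed (use that in \<open>auto simp: h0_new KV I_def\<close>)
      then show ?thesis by (auto simp: KE h_Inl)
    qed
    fix c z assume "c \<in> hedges K" "z \<in> c"
    then obtain e x where e: "c = Inl ` e" "e \<in> ?E" "z = Inl x" "x \<in> e" by (auto simp: KE)
    show "r z < r (h c)"
    proof (cases "e \<in> g ` J")
      case True
      then obtain i where i: "i \<in> J" "e = g i" by auto
      then obtain j where "j < i" "x = v j" using before e by blast
      then show ?thesis using i J e by (auto simp: h_Inl h0_g r_v)
    next
      case False
      have "x \<in> v ` {..<n}" using E e v_V by auto
      then show ?thesis using False e by (auto simp: h_Inl h0_new r_v) (simp add: r_def)
    qed
  qed
  ultimately show ?thesis
    unfolding hypercompetition_realizable_def K_def using finI by blast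
qed

section \<open>Connected orderings\<close>

lemma connected_graph_edge_leaving:
  assumes G: "is_connected_graph G" and S: "S \<subseteq> hverts G" "S \<noteq> {}" "S \<noteq> hverts G"
  obtains u w where "u \<in> S" "w \<in> hverts G - S" "{u, w} \<in> hedges G"
proof -
  let ?D = "with_proj \<lparr> pverts = hverts G, parcs = {(u, v). {u, v} \<in> hedges G} \<rparr>"
  obtain a b where ab: "a \<in> S" "b \<in> hverts G" "b \<notin> S" using S by auto
  have "a \<rightarrow>\<^sup>*\<^bsub>mk_symmetric ?D\<^esub> b"
    using G ab S(1) by (auto simp: is_connected_graph_def connected_def strongly_connected_def)
  then have "(a, b) \<in> (parcs (mk_symmetric ?D))\<^sup>*"
    by (auto dest: reachable_rtranclI)
  then have "\<exists>u w. u \<in> S \<and> w \<notin> S \<and> (u, w) \<in> parcs (mk_symmetric ?D)"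
    using ab(1,3) by (induction rule: converse_rtrancl_induct) blast+
  then obtain u w where uw: "u \<in> S" "w \<notin> S" "{u, w} \<in> hedges G"
    by (auto simp: parcs_mk_symmetric insert_commute)
  moreover have "w \<in> hverts G"
    using uw(3) G by (auto simp: is_connected_graph_def is_graph_def is_hypergraph_def)
  ultimately show ?thesis using that by blast
qed

text \<open>
  The enumeration grows greedily: as long as the enumerated vertices are not all, some edge leaves
  them, and its outer end is the next vertex.
\<close>
lemma connected_graph_ordering:
  assumes G: "is_connected_graph G"
  obtains v where "bij_betw v {..<card (hverts G)} (hverts G)"
    and "\<And>i. 0 < i \<Longrightarrow> i < card (hverts G) \<Longrightarrow> \<exists>j<i. {v j, v i} \<in> hedges G"
proof -
  let ?V = "hverts G" and ?E = "hedges G"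
  have fV: "finite ?V" and V: "?V \<noteq> {}"
    using G by (auto simp: is_connected_graph_def is_graph_def is_hypergraph_def)
  have "\<exists>v. inj_on v {..<m} \<and> v ` {..<m} \<subseteq> ?V \<and> (\<forall>i<m. 0 < i \<longrightarrow> (\<exists>j<i. {v j, v i} \<in> ?E))"
    if "m \<le> card ?V" for m
    using that
  proof (induction m)
    case (Suc m)
    then obtain v where v: "inj_on v {..<m}" "v ` {..<m} \<subseteq> ?V"
      "\<forall>i<m. 0 < i \<longrightarrow> (\<exists>j<i. {v j, v i} \<in> ?E)" by auto
    have "\<exists>w \<in> ?V - v ` {..<m}. 0 < m \<longrightarrow> (\<exists>j<m. {v j, w} \<in> ?E)"
    proof (cases "m = 0")
      case False
      have "card (v ` {..<m}) = m" using v(1) by (simp add: card_image)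
      then have "v ` {..<m} \<noteq> ?V" using Suc.prems by auto
      with False v(2) obtain u w where "u \<in> v ` {..<m}" "w \<in> ?V - v ` {..<m}" "{u, w} \<in> ?E"
        using connected_graph_edge_leaving[OF G] by (metis image_is_empty lessThan_empty_iff)
      then show ?thesis by auto
    qed (use V in auto)
    then obtain w where w: "w \<in> ?V" "w \<notin> v ` {..<m}" "0 < m \<longrightarrow> (\<exists>j<m. {v j, w} \<in> ?E)"
      by auto
    have "inj_on (v(m := w)) {..<Suc m}"
      using v(1) w(2) by (auto simp: lessThan_Suc inj_on_def)
    moreover have "(v(m := w)) ` {..<Suc m} \<subseteq> ?V"
      using v(2) w(1) by auto
    moreover have "\<exists>j<i. {(v(m := w)) j, (v(m := w)) i} \<in> ?E" if "i < Suc m" "0 < i" for i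
    proof (cases "i = m")
      case True
      with w(3) that obtain j where "j < m" "{v j, w} \<in> ?E" by auto
      with True show ?thesis by (intro exI[of _ j]) auto
    next
      case False
      with that have "i < m" by simp
      with v(3) that obtain j where "j < i" "{v j, v i} \<in> ?E" by blast
      with False that show ?thesis by (intro exI[of _ j]) auto
    qed
    ultimately show ?case by blast
  qed auto
  from this[of "card ?V"] obtain v where v: "inj_on v {..<card ?V}" "v ` {..<card ?V} \<subseteq> ?V"
    "\<forall>i<card ?V. 0 < i \<longrightarrow> (\<exists>j<i. {v j, v i} \<in> ?E)" by auto
  have "v ` {..<card ?V} = ?V"
    using v(1,2) fV by (intro card_subset_eq) (auto simp: card_image)
  then show ?thesis using v that by (auto simp: bij_betw_def)
qed

section \<open>The hypercompetition number of a connected graph\<close>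

text \<open>
  The edge attaching a vertex to the earlier ones gets the next vertex of the enumeration as its
  head, hence the shift by one in \<open>g i\<close>.  The edge attaching the last vertex has no next vertex
  and is among those that receive new heads.
\<close>
lemma hypercompetition_realizable_connected_graph:
  assumes G: "is_connected_graph G" and V2: "2 \<le> card (hverts G)"
  obtains k where "hypercompetition_realizable G k"
    and "k + card (hverts G) = card (hedges G) + 2"
proof -
  let ?n = "card (hverts G)" and ?E = "hedges G"
  obtain v where v: "bij_betw v {..<?n} (hverts G)"
    and ex: "\<And>i. 0 < i \<Longrightarrow> i < ?n \<Longrightarrow> \<exists>j<i. {v j, v i} \<in> ?E"
    using connected_graph_ordering[OF G] by blast
  have H: "is_hypergraph G" using G by (simp add: is_connected_graph_def is_graph_def)
  then have finE: "finite ?E" by (rule finite_hedges)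
  obtain p where p: "\<And>i. 0 < i \<Longrightarrow> i < ?n \<Longrightarrow> p i < i \<and> {v (p i), v i} \<in> ?E"
    using ex by metis
  define J where "J = {2..<?n}"
  define g where "g i = {v (p (i - 1)), v (i - 1)}" for i
  have p': "p (i - 1) < i - 1" "g i \<in> ?E" if "i \<in> J" for i
    using p[of "i - 1"] that by (auto simp: J_def g_def)
  have before: "g i \<subseteq> v ` {..<i}" if "i \<in> J" for i
    using p'(1)[OF that] by (auto simp: g_def)
  have new: "v (j - 1) \<notin> g i" if "i \<in> J" "j \<in> J" "i < j" for i j
  proof
    assume "v (j - 1) \<in> g i"
    then obtain l where l: "l < i" "v (j - 1) = v l" using before[OF \<open>i \<in> J\<close>] by auto
    then have "j - 1 = l"
      using v that by (intro inj_onD[of v "{..<?n}"]) (auto simp: bij_betw_def J_def)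
    then show False using l that by simp
  qed
  have inj: "inj_on g J"
  proof (rule linorder_inj_onI')
    fix i j assume "i \<in> J" "j \<in> J" "i < j"
    moreover have "v (j - 1) \<in> g j" by (simp add: g_def)
    ultimately show "g i \<noteq> g j" using new by metis
  qed
  have sub: "g ` J \<subseteq> ?E" using p'(2) by auto
  have "hypercompetition_realizable G (card (?E - g ` J))"
    using H v _ inj sub before
    by (rule hypercompetition_realizable_if_heads_in_ordering) (auto simp: J_def)
  moreover have "card (?E - g ` J) + ?n = card ?E + 2"
  proof -
    have "card (g ` J) = ?n - 2" using inj by (simp add: card_image J_def)
    moreover have "card (g ` J) \<le> card ?E" using finE sub by (rule card_mono)
    ultimately show ?thesis
      using card_Diff_subset[OF finite_subset[OF sub finE] sub] V2 by linarith
  qed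
  ultimately show ?thesis using that by blast
qed

theorem corollary2p6:
  fixes G :: "'a hypergraph"
  assumes "is_connected_graph G"
    and "card (hverts G) \<ge> 2"
  shows "int (hypercompetition_number G) = int (card (hedges G)) - int (card (hverts G)) + 2"
proof -
  obtain k where k: "hypercompetition_realizable G k" "k + card (hverts G) = card (hedges G) + 2"
    using hypercompetition_realizable_connected_graph[OF assms] .
  have H: "is_hypergraph G" using assms(1) by (simp add: is_connected_graph_def is_graph_def)
  have "hypercompetition_number G = k"
    unfolding hypercompetition_number_def
  proof (rule Least_equality)
    fix k' assume "hypercompetition_realizable G k'"
    with hypercompetition_realizable_lower_bound[OF H assms(2)] k(2) show "k \<le> k'" by fastforce
  qed (fact k(1))
  then show ?thesis using k(2) by linarith
qed

end
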